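(* Given two positive integers $N>k$, the combinatorial disjunctive constraint of $\mathrm{SOS}k(N)$, i.e. $\mathrm{CDC}(\mathcal{S})$ with $\mathcal{S}=\{\llbracket i,i+k-1\rrbracket\}_{i=1}^{N-k+1}$, admits a junction tree. Therefore, $\mathrm{SOS}k(N)$ is pairwise IB-representable.
   Context: Notation: $\llbracket a,c\rrbracket=\{a,\dots,c\}$, $\llbracket N\rrbracket=\{1,\dots,N\}$, $\Delta^N=\{\lambda\in\mathbb{R}^N_{\ge0}:\sum_i\lambda_i=1\}$. $\mathrm{SOS}k(N):=\bigcup_{i=1}^{N-k+1}\{\lambda\in\Delta^N:\lambda_j=0\ \forall j\in\llbracket N\rrbracket\setminus\llbracket i,i+k-1\rrbracket\}$. For a finite collection $\mathcal{S}$ of finite sets with $J=\bigcup_{S\in\mathcal{S}}S$, let $Q(S):=\{\lambda\in\mathbb{R}^J:\sum_{v\in J}\lambda_v=1,\ \lambda_{J\setminus S}=0,\ \lambda\ge0\}$ for $S\subseteq J$ and $\mathrm{CDC}(\mathcal{S}):=\bigcup_{S\in\mathcal{S}}Q(S)$. It is pairwise IB-representable if $\mathrm{CDC}(\mathcal{S})=\bigcap_{j=1}^t(Q(L^j)\cup Q(R^j))$ for some $t$ and $L^j,R^j\subseteq J$. For an edge $S^1S^2$ of a graph on vertex set $\mathcal{S}$, $\mathrm{mid}(S^1S^2)=S^1\cap S^2$. A junction tree of $\mathrm{CDC}(\mathcal{S})$ is a tree with vertex set $\mathcal{S}$ such that for any $S^1,S^2\in\mathcal{S}$ the unique path $\mathcal{P}$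 between them satisfies $S^1\cap S^2\subseteq S$ for every vertex $S$ of $\mathcal{P}$ and $S^1\cap S^2\subseteq\mathrm{mid}(e)$ for every edge $e$ of $\mathcal{P}$. $\mathrm{CDC}(\mathcal{S})$ admits a junction tree if such a tree exists. *)

theory Defs
  imports Complex_Main "HOL-Library.FuncSet" "Graph_Theory.Graph_Theory"
begin

text \<open>
  For a finite index set \<open>J\<close>, the space of real vectors indexed by \<open>J\<close> is rendered as
  \<open>J \<rightarrow>\<^sub>E UNIV\<close>, so that vectors are determined by their coordinates in \<open>J\<close>.
\<close>

definition std_simplex :: "nat \<Rightarrow> (nat \<Rightarrow> real) set" where
  "std_simplex N =
     {x \<in> {1..N} \<rightarrow>\<^sub>E UNIV. (\<forall>i\<in>{1..N}. 0 \<le> x i) \<and> (\<Sum>i\<in>{1..N}. x i) = 1}"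

definition SOS :: "nat \<Rightarrow> nat \<Rightarrow> (nat \<Rightarrow> real) set" where
  "SOS k N =
     (\<Union>i\<in>{1..N - k + 1}. {x \<in> std_simplex N. \<forall>j\<in>{1..N} - {i..i + k - 1}. x j = 0})"

definition sos_sets :: "nat \<Rightarrow> nat \<Rightarrow> nat set set" where
  "sos_sets k N = (\<lambda>i. {i..i + k - 1}) ` {1..N - k + 1}"

definition Q :: "'a set \<Rightarrow> 'a set \<Rightarrow> ('a \<Rightarrow> real) set" where
  "Q J S =
     {x \<in> J \<rightarrow>\<^sub>E UNIV. (\<Sum>v\<in>J. x v) = 1 \<and> (\<forall>v\<in>J - S. x v = 0) \<and> (\<forall>v\<in>J. 0 \<le> x v)}"

definition CDC :: "'a set set \<Rightarrow> ('a \<Rightarrow> real) set" where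
  "CDC \<S> = (\<Union>S\<in>\<S>. Q (\<Union>\<S>) S)"

text \<open>
  The number \<open>t\<close> is effectively positive: for \<open>t = 0\<close> the intersection is \<open>UNIV\<close>, which is
  never of the form \<open>CDC \<S>\<close>.
\<close>

definition pairwise_IB_representable :: "'a set set \<Rightarrow> bool" where
  "pairwise_IB_representable \<S> \<longleftrightarrow>
     (\<exists>(t::nat) L R. (\<forall>j\<in>{1..t}. L j \<subseteq> \<Union>\<S> \<and> R j \<subseteq> \<Union>\<S>) \<and>
        CDC \<S> = (\<Inter>j\<in>{1..t}. Q (\<Union>\<S>) (L j) \<union> Q (\<Union>\<S>) (R j)))"

text \<open>
  Undirected simple graphs are the finite, loop-free, symmetric digraphs of \<open>pair_graph\<close>, an
  edge being a pair of opposite arcs. The library predicate \<open>tree\<close> forbids directed cycles, and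
  in a symmetric digraph every edge \<open>uv\<close> yields the directed cycle \<open>u, v, u\<close>. The cycles of
  the undirected graph are those of length at least 3.
\<close>

definition undirected_tree :: "'a pair_pre_digraph \<Rightarrow> bool" where
  "undirected_tree T \<longleftrightarrow>
     pair_graph T \<and> Digraph_Component.connected (with_proj T) \<and>
     \<not> (\<exists>c. pre_digraph.cycle (with_proj T) c \<and> 3 \<le> length c)"

definition mid :: "'a set \<times> 'a set \<Rightarrow> 'a set" where
  "mid e = fst e \<inter> snd e"

text \<open>In a tree there is exactly one \<open>P\<close> as quantified below for given \<open>S1\<close> and \<open>S2\<close>.\<close>

definition junction_tree :: "'a set set \<Rightarrow> 'a set pair_pre_digraph \<Rightarrow> bool" where
  "junction_tree \<S> T \<longleftrightarrow>
     undirected_tree T \<and> pverts T = \<S> \<and>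
     (\<forall>S1\<in>\<S>. \<forall>S2\<in>\<S>. \<forall>P. vpath P (with_proj T) \<and> hd P = S1 \<and> last P = S2 \<longrightarrow>
        (\<forall>S\<in>set P. S1 \<inter> S2 \<subseteq> S) \<and> (\<forall>e\<in>set (vwalk_arcs P). S1 \<inter> S2 \<subseteq> mid e))"

definition admits_junction_tree :: "'a set set \<Rightarrow> bool" where
  "admits_junction_tree \<S> \<longleftrightarrow> (\<exists>T. junction_tree \<S> T)"

end

theory Submission
  imports Defs
begin

text \<open>
  The sets of \<open>SOSk(N)\<close> form a sequence \<open>f 1, \<dots>, f M\<close> with the running intersection property
  \<open>f a \<inter> f b \<subseteq> f c\<close> for \<open>a \<le> c \<le> b\<close>. Hence the path \<open>f 1 - \<dots> - f M\<close> is a junction tree: a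
  repetition-free walk on a path is monotone, so it stays between its endpoints, and it cannot
  close up to a cycle of length at least 3. Deleting the edge between \<open>f j\<close> and \<open>f (j + 1)\<close>
  gives the two unions \<open>L j = f 1 \<union> \<dots> \<union> f j\<close> and \<open>R j = f (j + 1) \<union> \<dots> \<union> f M\<close>. If \<open>i\<close> is least
  with the support of \<open>x\<close> inside \<open>L i\<close>, then the support also lies in \<open>R (i - 1)\<close>, hence in
  \<open>L i \<inter> R (i - 1) = f i\<close>.
\<close>

section \<open>Repetition-free walks on the natural numbers\<close>

definition path_adj :: "nat \<Rightarrow> nat \<Rightarrow> bool" where
  "path_adj i j \<longleftrightarrow> j = Suc i \<or> i = Suc j"

text \<open>Turning back after a unit step returns to the vertex just left, which distinctness
  forbids. The descending case is written as a sum to avoid truncated subtraction on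
  \<open>nat\<close>.\<close>

lemma distinct_path_walk_monotone:
  assumes "successively path_adj (x # xs)" and "distinct (x # xs)"
  shows "(\<forall>i\<le>length xs. (x # xs) ! i = x + i) \<or> (\<forall>i\<le>length xs. (x # xs) ! i + i = x)"
  using assms
proof (induction xs arbitrary: x)
  case (Cons y ys)
  from Cons.prems have adj: "path_adj x y"
    and IH: "(\<forall>i\<le>length ys. (y # ys) ! i = y + i) \<or> (\<forall>i\<le>length ys. (y # ys) ! i + i = y)"
    using Cons.IH[of y] by simp_all
  \<comment> \<open>This forces the step from \<open>x\<close> to \<open>y\<close> to have the same
    direction as the step that follows it.\<close>
  have turn: "ys = [] \<or> ys ! 0 \<noteq> x"
    using Cons.prems(2) by (cases ys) auto
  show ?case
  proof (cases "ys = []")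
    case True
    with adj show ?thesis by (auto simp: path_adj_def le_Suc_eq)
  next
    case False
    then have ne: "1 \<le> length ys" by (simp add: Suc_le_eq)
    from IH show ?thesis
    proof
      assume up: "\<forall>i\<le>length ys. (y # ys) ! i = y + i"
      with ne have "ys ! 0 = y + 1" by fastforce
      with turn False adj have "y = Suc x" by (auto simp: path_adj_def)
      with up have "\<forall>i\<le>length (y # ys). (x # y # ys) ! i = x + i"
        by (auto simp: nth_Cons split: nat.split)
      then show ?thesis ..
    next
      assume down: "\<forall>i\<le>length ys. (y # ys) ! i + i = y"
      with ne have "ys ! 0 + 1 = y" by fastforce
      with turn False adj have "x = Suc y" by (auto simp: path_adj_def)
      with down have "\<forall>i\<le>length (y # ys). (x # y # ys) ! i + i = x"
        by (auto simp: nth_Cons split: nat.split)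
      then show ?thesis ..
    qed
  qed
qed simp

lemma distinct_path_walk_between:
  assumes "successively path_adj xs" and "distinct xs" and "z \<in> set xs"
  shows "hd xs \<le> z \<and> z \<le> last xs \<or> last xs \<le> z \<and> z \<le> hd xs"
proof -
  obtain x ys where xs: "xs = x # ys" using assms(3) by (cases xs) auto
  obtain i where i: "i \<le> length ys" "z = xs ! i"
    using assms(3) unfolding xs by (metis in_set_conv_nth length_Cons less_Suc_eq_le)
  have last: "last xs = xs ! length ys" by (simp add: xs last_conv_nth)
  from distinct_path_walk_monotone[of x ys] assms(1,2)
  have "(\<forall>i\<le>length ys. xs ! i = x + i) \<or> (\<forall>i\<le>length ys. xs ! i + i = x)"
    by (simp add: xs)
  then show ?thesis
  proof
    assume "\<forall>i\<le>length ys. xs ! i = x + i"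
    with i(1) show ?thesis unfolding i(2) last by (simp add: xs)
  next
    assume "\<forall>i\<le>length ys. xs ! i + i = x"
    with i(1) have "xs ! i + i = x" "xs ! length ys + length ys = x" by auto
    with i show ?thesis unfolding i(2) last by (simp add: xs)
  qed
qed

text \<open>If \<open>xs\<close> is nonempty, it runs monotonically from a neighbour of
  \<open>x\<close> to \<open>x\<close>, so it covers distance 1. Going to a neighbour and back
  attains the bound.\<close>

lemma path_closed_walk_length:
  assumes "successively path_adj (x # xs)" and "distinct xs" and "last (x # xs) = x"
  shows "length xs \<le> 2"
proof (cases xs)
  case (Cons y ys)
  have adj: "path_adj x y" using assms(1) by (simp add: Cons)
  have "last xs = (y # ys) ! length ys" by (simp add: Cons last_conv_nth)
  with assms(3) have "(y # ys) ! length ys = x" by (simp add: Cons)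
  with distinct_path_walk_monotone[of y ys] assms(1,2)
  have "x = y + length ys \<or> x + length ys = y" by (auto simp: Cons)
  with adj show ?thesis by (auto simp: path_adj_def Cons)
qed simp

section \<open>Path graphs as undirected trees and junction trees\<close>

definition path_graph :: "(nat \<Rightarrow> 'a) \<Rightarrow> nat \<Rightarrow> 'a pair_pre_digraph" where
  "path_graph f M =
     \<lparr>pverts = f ` {1..M},
      parcs = {(f i, f j) | i j. i \<in> {1..M} \<and> j \<in> {1..M} \<and> path_adj i j}\<rparr>"

lemma pair_graph_path_graph:
  assumes "inj_on f {1..M}"
  shows "pair_graph (path_graph f M)"
proof
  have "parcs (path_graph f M) \<subseteq> f ` {1..M} \<times> f ` {1..M}"
    by (auto simp: path_graph_def)
  then show "finite (parcs (path_graph f M))"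
    by (rule finite_subset) simp
  show "symmetric (with_proj (path_graph f M))"
    by (auto simp: symmetric_def path_graph_def path_adj_def intro!: symI)
next
  fix e assume "e \<in> parcs (path_graph f M)"
  then show "fst e \<noteq> snd e"
    using assms by (auto simp: path_graph_def path_adj_def inj_on_eq_iff)
qed (auto simp: path_graph_def)

lemma connected_path_graph:
  assumes "inj_on f {1..M}" and "1 \<le> M"
  shows "Digraph_Component.connected (with_proj (path_graph f M))"
proof -
  let ?G = "path_graph f M"
  interpret G: pair_graph ?G using assms(1) by (rule pair_graph_path_graph)
  \<comment> \<open>Induction covers ascending indices; descending ones follow from the symmetry of
    the graph.\<close>
  have up: "f i \<rightarrow>\<^sup>*\<^bsub>with_proj ?G\<^esub> f j" if "1 \<le> i" "i \<le> j" "j \<le> M" for i j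
    using that(2,3)
  proof (induction j rule: dec_induct)
    case base
    with that have "f i \<in> pverts ?G" by (auto simp: path_graph_def)
    then show ?case by (rule G.reachable_refl)
  next
    case (step n)
    have "f n \<rightarrow>\<^bsub>with_proj ?G\<^esub> f (Suc n)"
      using step that(1) by (fastforce simp: path_graph_def path_adj_def)
    with step show ?case using G.reachable_adj_trans by auto
  qed
  have reach: "f i \<rightarrow>\<^sup>*\<^bsub>with_proj ?G\<^esub> f j" if "i \<in> {1..M}" "j \<in> {1..M}" for i j
    using that up[of i j] up[of j i] G.symmetric_reachable' by (cases "i \<le> j") auto
  have verts: "pverts ?G = f ` {1..M}" by (simp add: path_graph_def)
  show ?thesis
    unfolding Digraph_Component.connected_def
  proof (rule strongly_connectedI)
    show "verts (with_proj (mk_symmetric (with_proj ?G))) \<noteq> {}"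
      using assms(2) by (simp add: verts)
    fix u v assume "u \<in> verts (with_proj (mk_symmetric (with_proj ?G)))"
      and "v \<in> verts (with_proj (mk_symmetric (with_proj ?G)))"
    with reach show "u \<rightarrow>\<^sup>*\<^bsub>with_proj (mk_symmetric (with_proj ?G))\<^esub> v"
      by (auto simp: verts intro!: G.reachable_mk_symmetricI)
  qed
qed

lemma successively_vwalk_arcs:
  "successively R xs \<longleftrightarrow> (\<forall>(x, y) \<in> set (vwalk_arcs xs). R x y)"
  by (induction xs rule: vwalk_arcs.induct) auto

text \<open>Injectivity lets walks in the graph be read as walks on indices, where monotonicity
  applies.\<close>

lemma vwalk_arcs_path_graph:
  assumes "inj_on f {1..M}" and "set (vwalk_arcs P) \<subseteq> parcs (path_graph f M)"
  shows "successively path_adj (map (inv_into {1..M} f) P)"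
proof -
  have "path_adj (inv_into {1..M} f x) (inv_into {1..M} f y)"
    if "(x, y) \<in> set (vwalk_arcs P)" for x y
  proof -
    from that assms(2) obtain i j where "x = f i" "y = f j" "i \<in> {1..M}" "j \<in> {1..M}" "path_adj i j"
      by (auto simp: path_graph_def)
    then show ?thesis using inv_into_f_f[OF assms(1)] by simp
  qed
  then show ?thesis
    unfolding successively_map by (auto simp: successively_vwalk_arcs)
qed

text \<open>Cycles are lists of arcs; this passes to their vertex lists, whose tails have exactly
  one entry per arc.\<close>

lemma pcas_vertices:
  assumes "pcas u c v"
  shows "vwalk_arcs (u # map snd c) = c" and "last (u # map snd c) = v"
    and "pawalk_verts u c = u # map snd c"
  using assms by (induction c arbitrary: u) (auto simp: prod_eq_iff)

lemma path_graph_cycle_length: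
  assumes inj: "inj_on f {1..M}" and cyc: "pre_digraph.cycle (with_proj (path_graph f M)) c"
  shows "length c \<le> 2"
proof -
  interpret G: pair_graph "path_graph f M" using inj by (rule pair_graph_path_graph)
  let ?g = "inv_into {1..M} f"
  from cyc obtain u where walk: "G.awalk u c u" and dist: "distinct (tl (pawalk_verts u c))"
    by (auto simp: G.cycle_def)
  from walk have cas: "pcas u c u" and arcs: "set c \<subseteq> parcs (path_graph f M)"
    and "set (pawalk_verts u c) \<subseteq> pverts (path_graph f M)"
    by (blast elim: G.awalkE')+
  then have verts: "set (pawalk_verts u c) \<subseteq> f ` {1..M}" by (simp add: path_graph_def)
  note vs = pcas_vertices[OF cas]
  have "successively path_adj (map ?g (u # map snd c))"
    by (rule vwalk_arcs_path_graph[OF inj]) (simp only: vs arcs)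
  moreover have "inj_on ?g (set (map snd c))"
    using verts by (intro inj_on_inv_into) (auto simp: vs(3))
  then have "distinct (map ?g (map snd c))"
    using dist by (auto simp: vs(3) distinct_map simp del: map_map)
  moreover have "last (map ?g (u # map snd c)) = ?g u"
    by (subst last_map) (use vs(2) in auto)
  ultimately show ?thesis
    using path_closed_walk_length[of "?g u" "map ?g (map snd c)"] by simp
qed

lemma path_graph_undirected_tree:
  assumes "inj_on f {1..M}" and "1 \<le> M"
  shows "undirected_tree (path_graph f M)"
  using pair_graph_path_graph[OF assms(1)] connected_path_graph[OF assms]
    path_graph_cycle_length[OF assms(1)]
  unfolding undirected_tree_def by fastforce

lemma admits_junction_tree_running_intersection:
  fixes f :: "nat \<Rightarrow> 'a set"
  assumes inj: "inj_on f {1..M}" and M: "1 \<le> M"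
    and rip: "\<And>a b c. 1 \<le> a \<Longrightarrow> a \<le> c \<Longrightarrow> c \<le> b \<Longrightarrow> b \<le> M \<Longrightarrow> f a \<inter> f b \<subseteq> f c"
  shows "admits_junction_tree (f ` {1..M})"
proof -
  let ?G = "path_graph f M" and ?g = "inv_into {1..M} f"
  have *: "hd P \<inter> last P \<subseteq> S" if P: "vpath P (with_proj ?G)" and S: "S \<in> set P" for P S
  proof -
    from P have sub: "set P \<subseteq> f ` {1..M}" and ne: "P \<noteq> []" and dist: "distinct P"
      and arcs: "set (vwalk_arcs P) \<subseteq> parcs ?G"
      by (auto simp: vpath_def vwalk_def path_graph_def)
    have fg: "f (?g T) = T" "1 \<le> ?g T" "?g T \<le> M" if "T \<in> set P" for T
      using that sub inv_into_into[of T f "{1..M}"] by (auto simp: f_inv_into_f)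
    have "distinct (map ?g P)"
      using dist sub by (simp add: distinct_map inj_on_inv_into)
    with vwalk_arcs_path_graph[OF inj arcs] distinct_path_walk_between[of "map ?g P" "?g S"] S ne
    have "?g (hd P) \<le> ?g S \<and> ?g S \<le> ?g (last P) \<or> ?g (last P) \<le> ?g S \<and> ?g S \<le> ?g (hd P)"
      by (auto simp: hd_map last_map)
    \<comment> \<open>Two instances of \<open>rip\<close>, since the path may traverse the indices
      upwards or downwards.\<close>
    then show ?thesis
      using rip[of "?g (hd P)" "?g S" "?g (last P)"] rip[of "?g (last P)" "?g S" "?g (hd P)"]
        fg[OF S] fg[OF hd_in_set[OF ne]] fg[OF last_in_set[OF ne]]
      by auto
  qed
  have ends: "x \<in> set P \<and> y \<in> set P" if "(x, y) \<in> set (vwalk_arcs P)" for x y and P :: "'a set list"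
    using that by (induction P rule: vwalk_arcs.induct) auto
  have "junction_tree (f ` {1..M}) ?G"
    unfolding junction_tree_def
  proof (intro conjI ballI allI impI; (elim conjE)?)
    show "undirected_tree ?G" using inj M by (rule path_graph_undirected_tree)
    show "pverts ?G = f ` {1..M}" by (simp add: path_graph_def)
    fix S1 S2 P assume P: "vpath P (with_proj ?G)" "hd P = S1" "last P = S2"
    show "S1 \<inter> S2 \<subseteq> S" if "S \<in> set P" for S
      using *[OF P(1) that] P by simp
    \<comment> \<open>Both ends of \<open>e\<close> lie on \<open>P\<close>, and
      \<open>mid e\<close> is their intersection, so the vertex condition suffices.\<close>
    show "S1 \<inter> S2 \<subseteq> mid e" if "e \<in> set (vwalk_arcs P)" for e
    proof -
      obtain x y where e: "e = (x, y)" by (cases e)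
      with that ends have "x \<in> set P" "y \<in> set P" by auto
      with *[OF P(1)] P show ?thesis by (auto simp: mid_def e)
    qed
  qed
  then show ?thesis by (auto simp: admits_junction_tree_def)
qed

section \<open>Pairwise IB-representability\<close>

lemma Q_mono: "S \<subseteq> T \<Longrightarrow> Q J S \<subseteq> Q J T"
  by (auto simp: Q_def)

lemma Q_Int: "Q J (S \<inter> T) = Q J S \<inter> Q J T"
  by (auto simp: Q_def)

lemma Q_empty: "Q J {} = {}"
  by (auto simp: Q_def)

lemma pairwise_IB_representable_running_intersection:
  fixes f :: "nat \<Rightarrow> 'a set"
  assumes M: "1 \<le> M"
    and rip: "\<And>a b c. 1 \<le> a \<Longrightarrow> a \<le> c \<Longrightarrow> c \<le> b \<Longrightarrow> b \<le> M \<Longrightarrow> f a \<inter> f b \<subseteq> f c"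
  shows "pairwise_IB_representable (f ` {1..M})"
proof -
  define J where "J = \<Union>(f ` {1..M})"
  \<comment> \<open>Since \<open>R M = {}\<close> and \<open>Q J {} = {}\<close>, the index \<open>M\<close> only expresses membership in the simplex.\<close>
  define L where "L j = \<Union>(f ` {1..j})" for j
  define R where "R j = \<Union>(f ` {Suc j..M})" for j
  have sub: "L j \<subseteq> J \<and> R j \<subseteq> J" if "j \<in> {1..M}" for j
    using that unfolding L_def R_def J_def by (intro conjI Union_mono image_mono) auto
  have "CDC (f ` {1..M}) = (\<Inter>j\<in>{1..M}. Q J (L j) \<union> Q J (R j))"
  proof (intro equalityI subsetI INT_I)
    fix x j assume "x \<in> CDC (f ` {1..M})" and j: "j \<in> {1..M}"
    then obtain i where i: "i \<in> {1..M}" "x \<in> Q J (f i)" by (auto simp: CDC_def J_def)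
    show "x \<in> Q J (L j) \<union> Q J (R j)"
    proof (cases "i \<le> j")
      case True
      with i have "f i \<subseteq> L j" by (auto simp: L_def)
      with i show ?thesis using Q_mono by blast
    next
      case False
      with i have "i \<in> {Suc j..M}" by simp
      then have "f i \<subseteq> R j" by (auto simp only: R_def)
      with i show ?thesis using Q_mono by blast
    qed
  next
    fix x assume x: "x \<in> (\<Inter>j\<in>{1..M}. Q J (L j) \<union> Q J (R j))"
    \<comment> \<open>The search starts at 0, where \<open>L 0 = {}\<close> makes
      \<open>Q J (L 0)\<close> empty; hence the least index has a predecessor
      \<open>m\<close>.\<close>
    define i where "i = (LEAST i. x \<in> Q J (L i))"
    have "x \<in> Q J (L M)" using x M by (auto simp: R_def Q_empty)
    then have i: "x \<in> Q J (L i)" and le: "i \<le> M"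
      unfolding i_def by (auto intro: LeastI Least_le)
    have "i \<noteq> 0" using i by (auto simp: L_def Q_empty intro: ccontr)
    then obtain m where m: "i = Suc m" by (cases i) auto
    have "x \<notin> Q J (L m)" using not_less_Least[of m "\<lambda>i. x \<in> Q J (L i)"] m by (simp add: i_def)
    have "x \<in> Q J (f i)"
    \<comment> \<open>There is no constraint with index 0, but for \<open>m = 0\<close> the set
      \<open>L i\<close> is already \<open>f i\<close>.\<close>
    proof (cases "m = 0")
      case True
      with i show ?thesis by (simp add: L_def m)
    next
      case False
      with x \<open>x \<notin> Q J (L m)\<close> le m have "x \<in> Q J (R m)" by auto
      with i have "x \<in> Q J (L i \<inter> R m)" by (simp add: Q_Int)
      \<comment> \<open>A common point lies in some \<open>f a\<close> with \<open>a \<le> i\<close>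
        and in some \<open>f b\<close> with \<open>i \<le> b\<close>, so \<open>rip\<close> puts it
        in \<open>f i\<close>.\<close>
      moreover have "L i \<inter> R m \<subseteq> f i"
        using rip[of _ i] by (fastforce simp: L_def R_def m)
      ultimately show ?thesis using Q_mono by blast
    qed
    with le m show "x \<in> CDC (f ` {1..M})" by (auto simp: CDC_def J_def)
  qed
  with sub show ?thesis
    unfolding pairwise_IB_representable_def J_def by blast
qed

section \<open>The windows of \<open>SOS k N\<close>\<close>

lemma Union_sos_sets:
  assumes "0 < k" and "k < N"
  shows "\<Union>(sos_sets k N) = {1..N}"
proof (intro equalityI subsetI)
  fix v assume v: "v \<in> {1..N}"
  \<comment> \<open>The window starting at \<open>v\<close>, or the last window if that one would
    overshoot \<open>N\<close>.\<close>
  define i where "i = min v (N - k + 1)"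
  have "i \<in> {1..N - k + 1}" "v \<in> {i..i + k - 1}"
    using assms v by (auto simp: i_def min_def)
  then show "v \<in> \<Union>(sos_sets k N)" by (auto simp: sos_sets_def)
qed (use assms in \<open>auto simp: sos_sets_def\<close>)

lemma SOS_eq_CDC:
  assumes "0 < k" and "k < N"
  shows "SOS k N = CDC (sos_sets k N)"
proof -
  have "CDC (sos_sets k N) = (\<Union>i\<in>{1..N - k + 1}. Q {1..N} {i..i + k - 1})"
    \<comment> \<open>\<open>sos_sets\<close> stays folded at first, so that the ground set can be
      rewritten to \<open>{1..N}\<close>.\<close>
    by (simp add: CDC_def Union_sos_sets[OF assms]) (simp add: sos_sets_def)
  also have "\<dots> = SOS k N"
    unfolding SOS_def by (intro SUP_cong) (auto simp: Q_def std_simplex_def)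
  finally show ?thesis ..
qed

theorem proposition11:
  fixes N k :: nat
  assumes "0 < k" and "k < N"
  shows "SOS k N = CDC (sos_sets k N) \<and>
         admits_junction_tree (sos_sets k N) \<and>
         pairwise_IB_representable (sos_sets k N)"
proof -
  let ?f = "\<lambda>i. {i..i + k - 1}"
  \<comment> \<open>Since \<open>0 < k\<close>, the windows are nonempty and determine their left
    ends.\<close>
  have inj: "inj_on ?f {1..N - k + 1}"
    using assms(1) by (auto simp: inj_on_def Icc_eq_Icc)
  \<comment> \<open>A common point is at least \<open>b\<close>, hence at least \<open>c\<close>,
    and at most \<open>a + k - 1\<close>, hence at most \<open>c + k - 1\<close>.\<close>
  have rip: "?f a \<inter> ?f b \<subseteq> ?f c" if "a \<le> c" "c \<le> b" for a b c
    using that by auto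
  have "admits_junction_tree (sos_sets k N)"
    unfolding sos_sets_def
    by (rule admits_junction_tree_running_intersection[OF inj]) (use rip in auto)
  moreover have "pairwise_IB_representable (sos_sets k N)"
    unfolding sos_sets_def
    by (rule pairwise_IB_representable_running_intersection) (use rip in auto)
  ultimately show ?thesis using SOS_eq_CDC[OF assms] by blast
qed

end
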